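(* Let $M/F$ be a field extension of degree $n$ with non-trivial $G=\mathrm{Aut}_F(M)$, and let $A$ be a central simple algebra over $F$ with maximal subfield $M$. Then $G$ is solvable if there exists a chain of subalgebras $$M=A_0\subset A_1\subset\dots\subset A_k\subset A$$ of $A$ which all have maximal subfield $M$, where $A_k$ is a $G$-crossed product algebra over $\mathrm{Fix}(G)$, and where $$A_{i+1}\cong A_i[t_i;\tau_i]/A_i[t_i;\tau_i](t_i^{q_i}-c_i)$$ for all $i\in\{0,\dots,k-1\}$, with (i) $q_i$ a prime; (ii) $\tau_i$ an $F$-automorphism of $A_i$ of inner order $q_i$ which restricts on $M$ to an automorphism $\sigma_{i+1}\in G$; and (iii) $c_i\in\mathrm{Fix}(\tau_i)^\times$.
   Context: All algebras are unital, associative and finite-dimensional. A central simple algebra over a field $Z$ has degree $n$ if its dimension over $Z$ is $n^2$; a maximal subfield of it is a subfield $M\supseteq Z$ with $[M:Z]=n$. For a group $H$ of automorphisms of $M$, $\mathrm{Fix}(H)$ is its fixed field in $M$; for an automorphism $\tau$ of a ring $S$, $\mathrm{Fix}(\tau)=\{s\in S:\tau(s)=s\}$, and $\mathrm{Fix}(\tau)^\times$ denotes its invertible elements. A central simple algebra over a field $Z$ is an $H$-crossed product algebra over $Z$ if it contains a maximal subfield that is Galois over $Z$ with Galois group $H$ (here the maximal subfield is $M$). For a ring $S$ and an automorphism $\tau$ of $S$, $S[t;\tau]$ is the twisted polynomial ring with $ta=\tau(a)t$ for $a\in S$. For monic $f\in S[t;\tau]$ of degree $m$, $S[t;\tau]/S[t;\tau]f$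 denotes the set of twisted polynomials of degree $<m$ with multiplication $g\circ h=$ remainder of $gh$ under right division by $f$; when $S[t;\tau]f$ is a two-sided ideal this is the usual quotient ring. The algebra $S$ is regarded as a subalgebra via constant polynomials, and the isomorphisms $A_{i+1}\cong A_i[t_i;\tau_i]/A_i[t_i;\tau_i](t_i^{q_i}-c_i)$ are understood to be compatible with the inclusion of $A_i$ in $A_{i+1}$. The inner order of an automorphism $\tau$ of $S$ is the smallest positive integer $m$ such that $\tau^m$ is an inner automorphism $z\mapsto uzu^{-1}$ of $S$. *)

theory Defs
  imports "HOL-Algebra.Algebra"
begin

section \<open>Central simple algebras and maximal subfields\<close>

text \<open>
  An algebra over a field is a (not necessarily commutative) ring \<open>B\<close> together with a
  subfield \<open>Z\<close> of its center; a subring \<open>S\<close> of \<open>B\<close> is turned into a ring by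
  \<open>B\<lparr>carrier := S\<rparr>\<close>. The locales \<open>subfield\<close> and \<open>ideal\<close> of the library do not assume the
  ambient ring to be commutative, and \<open>ideal\<close> is two-sided.
\<close>

definition ring_center :: "('a, 'b) ring_scheme \<Rightarrow> 'a set"
  where "ring_center B = {z \<in> carrier B. \<forall>x \<in> carrier B. z \<otimes>\<^bsub>B\<^esub> x = x \<otimes>\<^bsub>B\<^esub> z}"

definition central_simple_algebra :: "'a set \<Rightarrow> ('a, 'b) ring_scheme \<Rightarrow> bool"
  where "central_simple_algebra Z B \<longleftrightarrow>
    ring B \<and> subfield Z B \<and> ring_center B = Z \<and>
    (\<forall>I. ideal I B \<longrightarrow> I = {\<zero>\<^bsub>B\<^esub>} \<or> I = carrier B) \<and>
    ring.finite_dimension B Z (carrier B)"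

text \<open>In the next definition, \<open>d\<close> is the degree of \<open>B\<close>.\<close>

definition maximal_subfield :: "'a set \<Rightarrow> 'a set \<Rightarrow> ('a, 'b) ring_scheme \<Rightarrow> bool"
  where "maximal_subfield M Z B \<longleftrightarrow>
    central_simple_algebra Z B \<and> subfield M B \<and> Z \<subseteq> M \<and>
    (\<exists>d. ring.dimension B (d ^ 2) Z (carrier B) \<and> ring.dimension B d Z M)"


section \<open>Automorphism groups, Galois extensions and crossed products\<close>

text \<open>
  \<open>Aut_over R Z M\<close> is the group of automorphisms of the subfield \<open>M\<close> of \<open>R\<close> that fix \<open>Z\<close>
  pointwise. As in \<open>AutoGroup\<close>, its elements are extensional functions on \<open>M\<close>.
\<close>

definition Aut_over :: "('a, 'b) ring_scheme \<Rightarrow> 'a set \<Rightarrow> 'a set \<Rightarrow> ('a \<Rightarrow> 'a) monoid"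
  where "Aut_over R Z M = BijGroup M \<lparr>carrier :=
    {\<sigma> \<in> Bij M. \<sigma> \<in> ring_iso (R\<lparr>carrier := M\<rparr>) (R\<lparr>carrier := M\<rparr>) \<and> (\<forall>z \<in> Z. \<sigma> z = z)}\<rparr>"

definition fixed_field :: "'a set \<Rightarrow> ('a \<Rightarrow> 'a) monoid \<Rightarrow> 'a set"
  where "fixed_field M H = {x \<in> M. \<forall>\<sigma> \<in> carrier H. \<sigma> x = x}"

text \<open>Finite Galois extensions \<open>M/Z\<close> of subfields of \<open>R\<close>.\<close>

definition galois_extension :: "('a, 'b) ring_scheme \<Rightarrow> 'a set \<Rightarrow> 'a set \<Rightarrow> bool"
  where "galois_extension R Z M \<longleftrightarrow>
    subfield Z R \<and> subfield M R \<and> Z \<subseteq> M \<and> ring.finite_dimension R Z M \<and>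
    fixed_field M (Aut_over R Z M) = Z"

text \<open>\<open>B\<close> is an \<open>H\<close>-crossed product algebra over \<open>Z\<close>, by means of the maximal subfield \<open>M\<close>.\<close>

definition crossed_product_algebra ::
    "('a \<Rightarrow> 'a) monoid \<Rightarrow> 'a set \<Rightarrow> 'a set \<Rightarrow> ('a, 'b) ring_scheme \<Rightarrow> bool"
  where "crossed_product_algebra H Z M B \<longleftrightarrow>
    central_simple_algebra Z B \<and> maximal_subfield M Z B \<and>
    galois_extension B Z M \<and> Aut_over B Z M = H"


section \<open>Twisted polynomials and their quotients\<close>

text \<open>
  The twisted polynomial ring \<open>S[t; \<tau>]\<close> has the same elements and the same additive structure
  as the univariate polynomial ring \<open>UP S\<close>, where \<open>p\<close> stands for the sum of the \<open>p i t\<^sup>i\<close>, with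
  coefficients on the left. The rule \<open>t a = \<tau>(a) t\<close> gives \<open>(a t\<^sup>i) (b t\<^sup>j) = a \<tau>\<^sup>i(b) t\<^sup>i\<^sup>+\<^sup>j\<close>.
\<close>

definition twisted_UP ::
    "('a, 'b) ring_scheme \<Rightarrow> ('a \<Rightarrow> 'a) \<Rightarrow> ('a, nat \<Rightarrow> 'a) up_ring"
  where "twisted_UP S \<tau> = UP S \<lparr>mult :=
    (\<lambda>p \<in> up S. \<lambda>r \<in> up S. \<lambda>n. \<Oplus>\<^bsub>S\<^esub>i \<in> {..n}. p i \<otimes>\<^bsub>S\<^esub> (\<tau> ^^ i) (r (n - i)))\<rparr>"

definition polys_below :: "('a, 'b) ring_scheme \<Rightarrow> nat \<Rightarrow> (nat \<Rightarrow> 'a) set"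
  where "polys_below S m = {p \<in> up S. \<forall>i \<ge> m. p i = \<zero>\<^bsub>S\<^esub>}"

text \<open>
  For monic \<open>f\<close>, the remainder \<open>r\<close> of \<open>g\<close> under right division by \<open>f\<close>, that is
  \<open>g = h f + r\<close> with \<open>r\<close> of degree less than that of \<open>f\<close>, exists and is unique.
\<close>

definition right_remainder ::
    "('a, 'b) ring_scheme \<Rightarrow> ('a \<Rightarrow> 'a) \<Rightarrow> (nat \<Rightarrow> 'a) \<Rightarrow> (nat \<Rightarrow> 'a) \<Rightarrow> nat \<Rightarrow> 'a"
  where "right_remainder S \<tau> f g =
    (THE r. r \<in> polys_below S (deg S f) \<and>
      (\<exists>h \<in> up S. g = (h \<otimes>\<^bsub>twisted_UP S \<tau>\<^esub> f) \<oplus>\<^bsub>twisted_UP S \<tau>\<^esub> r))"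

text \<open>
  \<open>S[t; \<tau>]/S[t; \<tau>]f\<close>, for monic \<open>f\<close> of positive degree. The polynomial \<open>f\<close> need not
  generate a two-sided ideal, so the multiplication need not be associative.
\<close>

definition twisted_quotient ::
    "('a, 'b) ring_scheme \<Rightarrow> ('a \<Rightarrow> 'a) \<Rightarrow> (nat \<Rightarrow> 'a) \<Rightarrow> ('a, nat \<Rightarrow> 'a) up_ring"
  where "twisted_quotient S \<tau> f = twisted_UP S \<tau>
    \<lparr>carrier := polys_below S (deg S f),
     mult := (\<lambda>g h. right_remainder S \<tau> f (g \<otimes>\<^bsub>twisted_UP S \<tau>\<^esub> h))\<rparr>"

definition const_poly :: "('a, 'b) ring_scheme \<Rightarrow> ('a \<Rightarrow> 'a) \<Rightarrow> 'a \<Rightarrow> nat \<Rightarrow> 'a"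
  where "const_poly S \<tau> a = monom (twisted_UP S \<tau>) a 0"

text \<open>The twisted polynomial \<open>t\<^sup>m - c\<close>.\<close>

definition binomial_poly :: "('a, 'b) ring_scheme \<Rightarrow> ('a \<Rightarrow> 'a) \<Rightarrow> nat \<Rightarrow> 'a \<Rightarrow> nat \<Rightarrow> 'a"
  where "binomial_poly S \<tau> m c =
    monom (twisted_UP S \<tau>) \<one>\<^bsub>S\<^esub> m \<ominus>\<^bsub>twisted_UP S \<tau>\<^esub> const_poly S \<tau> c"

text \<open>
  The overring \<open>T\<close> of \<open>S\<close> is isomorphic to \<open>S[t; \<tau>]/S[t; \<tau>]f\<close>, by an isomorphism that maps
  each element of \<open>S\<close> to the corresponding constant polynomial. (In particular, the isomorphism
  is linear over every subfield of \<open>S\<close>.)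
\<close>

definition iso_twisted_quotient ::
    "('a, 'b) ring_scheme \<Rightarrow> ('a, 'b) ring_scheme \<Rightarrow> ('a \<Rightarrow> 'a) \<Rightarrow> (nat \<Rightarrow> 'a) \<Rightarrow> bool"
  where "iso_twisted_quotient T S \<tau> f \<longleftrightarrow>
    (\<exists>\<phi> \<in> ring_iso T (twisted_quotient S \<tau> f). \<forall>a \<in> carrier S. \<phi> a = const_poly S \<tau> a)"


section \<open>Ring automorphisms\<close>

text \<open>
  Ring automorphisms are elements of \<open>ring_iso S S\<close>; only their values on the carrier of \<open>S\<close>
  are relevant.
\<close>

definition inner_automorphism :: "('a, 'b) ring_scheme \<Rightarrow> ('a \<Rightarrow> 'a) \<Rightarrow> bool"
  where "inner_automorphism S \<tau> \<longleftrightarrow>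
    (\<exists>u \<in> Units S. \<forall>z \<in> carrier S. \<tau> z = u \<otimes>\<^bsub>S\<^esub> z \<otimes>\<^bsub>S\<^esub> inv\<^bsub>S\<^esub> u)"

definition has_inner_order :: "('a, 'b) ring_scheme \<Rightarrow> ('a \<Rightarrow> 'a) \<Rightarrow> nat \<Rightarrow> bool"
  where "has_inner_order S \<tau> m \<longleftrightarrow>
    0 < m \<and> inner_automorphism S (\<tau> ^^ m) \<and>
    (\<forall>j. 0 < j \<and> j < m \<longrightarrow> \<not> inner_automorphism S (\<tau> ^^ j))"

definition fixed_ring :: "('a, 'b) ring_scheme \<Rightarrow> ('a \<Rightarrow> 'a) \<Rightarrow> ('a, 'b) ring_scheme"
  where "fixed_ring S \<tau> = S\<lparr>carrier := {s \<in> carrier S. \<tau> s = s}\<rparr>"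

end

theory Submission
  imports Defs
begin

text \<open>
  Let \<open>Z\<^sub>i \<subseteq> M\<close> be the center of \<open>A\<^sub>i\<close> and \<open>G\<^sub>i \<le> G\<close> the subgroup fixing \<open>Z\<^sub>i\<close>, so that \<open>G\<^sub>0\<close> is
  trivial and \<open>G\<^sub>k = G\<close>. Inner automorphisms fix the center, so \<open>\<tau>\<^sub>i\<close> acts on \<open>Z\<^sub>i\<close> with finite
  order, and an element of \<open>Z\<^sub>i\<close> fixed by \<open>\<tau>\<^sub>i\<close> commutes with \<open>A\<^sub>i\<close> and with \<open>t\<^sub>i\<close>, hence lies in
  \<open>Z\<^sub>i\<^sub>+\<^sub>1\<close>. Every element of \<open>G\<^sub>i\<^sub>+\<^sub>1\<close> therefore acts on \<open>Z\<^sub>i\<close> as a power of \<open>\<tau>\<^sub>i\<close>, and so the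
  commutators of \<open>G\<^sub>i\<^sub>+\<^sub>1\<close> act trivially on \<open>Z\<^sub>i\<close>, that is, lie in \<open>G\<^sub>i\<close>.
\<close>

section \<open>Independence of characters\<close>

text \<open>Artin's induction on the number of characters: subtracting \<open>\<chi> k y\<close>
  times the relation at \<open>x\<close> from the relation at \<open>m y x\<close> eliminates the
  character \<open>k\<close> and leaves a shorter relation with coefficients
  \<open>a i \<otimes> (\<chi> i y \<ominus> \<chi> k y)\<close>. The domain \<open>Y\<close> is
  merely a set closed under \<open>m\<close>, so that it can be a subring with its zero
  included.\<close>

lemma (in domain) dedekind_independence:
  assumes "finite I"
    and "\<And>x y. x \<in> Y \<Longrightarrow> y \<in> Y \<Longrightarrow> m x y \<in> Y"
    and "\<And>i x. i \<in> I \<Longrightarrow> x \<in> Y \<Longrightarrow> \<chi> i x \<in> carrier R"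
    and "\<And>i x y. i \<in> I \<Longrightarrow> x \<in> Y \<Longrightarrow> y \<in> Y \<Longrightarrow> \<chi> i (m x y) = \<chi> i x \<otimes> \<chi> i y"
    and "\<And>i. i \<in> I \<Longrightarrow> \<exists>x\<in>Y. \<chi> i x \<noteq> \<zero>"
    and "\<And>i j. i \<in> I \<Longrightarrow> j \<in> I \<Longrightarrow> i \<noteq> j \<Longrightarrow> \<exists>x\<in>Y. \<chi> i x \<noteq> \<chi> j x"
    and "\<And>i. i \<in> I \<Longrightarrow> a i \<in> carrier R"
    and "\<And>x. x \<in> Y \<Longrightarrow> (\<Oplus>i\<in>I. a i \<otimes> \<chi> i x) = \<zero>"
  shows "\<forall>i\<in>I. a i = \<zero>"
  using assms
proof (induction I arbitrary: a rule: finite_induct)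
  case empty
  then show ?case by simp
next
  case (insert k I)
  note mult = insert.prems(1) and chi = insert.prems(2) and hom = insert.prems(3)
    and nz = insert.prems(4) and dist = insert.prems(5) and a = insert.prems(6)
    and rel = insert.prems(7)
  have rel': "a k \<otimes> \<chi> k x \<oplus> (\<Oplus>i\<in>I. a i \<otimes> \<chi> i x) = \<zero>" if "x \<in> Y" for x
    using rel[OF that] insert.hyps a chi[OF _ that] by (simp add: finsum_insert Pi_def)
  have I_zero: "a j = \<zero>" if j: "j \<in> I" for j
  proof -
    \<comment> \<open>The point \<open>y\<close> separates \<open>j\<close> from \<open>k\<close>,
      so the coefficient \<open>?b j\<close> of the shortened relation can vanish only if
      \<open>a j\<close> does.\<close>
    obtain y where y: "y \<in> Y" "\<chi> j y \<noteq> \<chi> k y"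
      using dist[of j k] j insert.hyps by blast
    let ?b = "\<lambda>i. a i \<otimes> (\<chi> i y \<ominus> \<chi> k y)"
    have "\<forall>i\<in>I. ?b i = \<zero>"
    proof (rule insert.IH)
      show "(\<Oplus>i\<in>I. ?b i \<otimes> \<chi> i x) = \<zero>" if x: "x \<in> Y" for x
      proof -
        have yx: "m y x \<in> Y" using mult x y by blast
        have cl: "a k \<in> carrier R" "\<chi> k x \<in> carrier R" "\<chi> k y \<in> carrier R"
          "\<And>i. i \<in> I \<Longrightarrow> a i \<in> carrier R" "\<And>i. i \<in> I \<Longrightarrow> \<chi> i x \<in> carrier R"
          "\<And>i. i \<in> I \<Longrightarrow> \<chi> i y \<in> carrier R"
          using a chi x y by auto
        have S: "(\<Oplus>i\<in>I. a i \<otimes> \<chi> i x) = \<ominus> (a k \<otimes> \<chi> k x)"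
        proof (rule minus_equality[symmetric])
          show "(\<Oplus>i\<in>I. a i \<otimes> \<chi> i x) \<oplus> a k \<otimes> \<chi> k x = \<zero>"
            using rel'[OF x] cl by (subst a_comm) (auto intro!: finsum_closed)
        qed (use cl in \<open>auto intro!: finsum_closed\<close>)
        have "(\<Oplus>i\<in>I. a i \<otimes> \<chi> i (m y x)) = (\<Oplus>i\<in>I. ?b i \<otimes> \<chi> i x \<oplus> \<chi> k y \<otimes> (a i \<otimes> \<chi> i x))"
        proof (rule finsum_cong')
          show "a i \<otimes> \<chi> i (m y x) = ?b i \<otimes> \<chi> i x \<oplus> \<chi> k y \<otimes> (a i \<otimes> \<chi> i x)"
            if i: "i \<in> I" for i
          proof -
            have "\<chi> i (m y x) = \<chi> i y \<otimes> \<chi> i x" using hom i x y by auto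
            then show ?thesis using cl(1-3) cl(4-6)[OF i] by algebra
          qed
        qed (use cl in auto)
        also have "\<dots> = (\<Oplus>i\<in>I. ?b i \<otimes> \<chi> i x) \<oplus> (\<Oplus>i\<in>I. \<chi> k y \<otimes> (a i \<otimes> \<chi> i x))"
          using cl by (intro finsum_addf) auto
        also have "(\<Oplus>i\<in>I. \<chi> k y \<otimes> (a i \<otimes> \<chi> i x)) = \<chi> k y \<otimes> (\<Oplus>i\<in>I. a i \<otimes> \<chi> i x)"
          using cl insert.hyps by (intro finsum_rdistr[symmetric]) auto
        \<comment> \<open>The relation at \<open>x\<close> turns the remaining sum into a negative
          \<open>k\<close>-term; it will cancel the \<open>k\<close>-term of the relation at
          \<open>m y x\<close>.\<close>
        finally have T: "(\<Oplus>i\<in>I. a i \<otimes> \<chi> i (m y x))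
          = (\<Oplus>i\<in>I. ?b i \<otimes> \<chi> i x) \<oplus> \<chi> k y \<otimes> \<ominus> (a k \<otimes> \<chi> k x)"
          unfolding S .
        have c: "(\<Oplus>i\<in>I. ?b i \<otimes> \<chi> i x) \<in> carrier R"
          using cl by (intro finsum_closed) auto
        have "\<chi> k (m y x) = \<chi> k y \<otimes> \<chi> k x" using hom x y by auto
        with rel'[OF yx] T
        have "a k \<otimes> (\<chi> k y \<otimes> \<chi> k x)
          \<oplus> ((\<Oplus>i\<in>I. ?b i \<otimes> \<chi> i x) \<oplus> \<chi> k y \<otimes> \<ominus> (a k \<otimes> \<chi> k x)) = \<zero>"
          by simp
        moreover have cancel: "p \<otimes> (q \<otimes> r) \<oplus> (s \<oplus> q \<otimes> \<ominus> (p \<otimes> r)) = s"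
          if "p \<in> carrier R" "q \<in> carrier R" "r \<in> carrier R" "s \<in> carrier R" for p q r s
          using that by algebra
        ultimately show ?thesis using cancel[OF cl(1) cl(3) cl(2) c] by simp
      qed
    qed (use mult chi hom nz dist a y in auto)
    then have "?b j = \<zero>" using j by blast
    moreover have "\<chi> j y \<in> carrier R" "\<chi> k y \<in> carrier R" "a j \<in> carrier R"
      using chi a j y by auto
    ultimately show ?thesis
      using y(2) integral[of "a j" "\<chi> j y \<ominus> \<chi> k y"] by auto
  qed
  obtain x where x: "x \<in> Y" "\<chi> k x \<noteq> \<zero>" using nz[of k] by blast
  have "(\<Oplus>i\<in>I. a i \<otimes> \<chi> i x) = (\<Oplus>i\<in>I. \<zero>)"
    using I_zero chi x by (intro finsum_cong') auto
  then have "a k \<otimes> \<chi> k x = \<zero>"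
    using rel'[OF x(1)] a chi x by simp
  then have "a k = \<zero>"
    using integral[of "a k" "\<chi> k x"] x a chi by auto
  with I_zero show ?case by auto
qed

section \<open>Finite sums under homomorphisms and along a cycle\<close>

lemma (in ring) hom_finsum_on_subring:
  assumes Z: "subring Z R" and h: "h \<in> ring_hom (R\<lparr>carrier := Z\<rparr>) R"
    and "finite J" "f \<in> J \<rightarrow> Z"
  shows "finsum R f J \<in> Z \<and> h (finsum R f J) = (\<Oplus>j\<in>J. h (f j))"
  using assms(3,4)
proof (induction J rule: finite_induct)
  case empty
  have z: "\<zero> \<in> Z" using subringE(2)[OF Z] .
  \<comment> \<open>Preservation of zero is not among the defining clauses of
    \<open>ring_hom\<close>; it follows by cancelling in
    \<open>h \<zero> \<oplus> h \<zero> = h \<zero>\<close>.\<close>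
  have "h \<zero> \<oplus> h \<zero> = h \<zero>" "h \<zero> \<in> carrier R"
    using ring_hom_memE(3)[OF h, of \<zero> \<zero>] ring_hom_memE(1)[OF h, of \<zero>] z by auto
  then show ?case using z by simp
next
  case (insert j J)
  have Zc: "x \<in> carrier R" if "x \<in> Z" for x using subringE(1)[OF Z] that by blast
  have hc: "h x \<in> carrier R" if "x \<in> Z" for x using ring_hom_memE(1)[OF h] that by auto
  have IH: "finsum R f J \<in> Z" "h (finsum R f J) = (\<Oplus>j\<in>J. h (f j))"
    using insert by auto
  have "finsum R f (insert j J) = f j \<oplus> finsum R f J"
    using insert Zc by (intro finsum_insert) auto
  moreover have "(\<Oplus>j\<in>insert j J. h (f j)) = h (f j) \<oplus> (\<Oplus>j\<in>J. h (f j))"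
    using insert hc by (intro finsum_insert) auto
  ultimately show ?case
    using IH insert.prems ring_hom_memE(3)[OF h, of "f j" "finsum R f J"] subringE(7)[OF Z]
    by auto
qed

text \<open>Splitting off the first or the last term of the sum over \<open>{..d}\<close> leaves the
  two sides, and these terms are equal. For \<open>f j = (\<tau> ^^ j) x\<close> this says that the
  trace of \<open>x\<close> is fixed by \<open>\<tau>\<close>.\<close>

lemma (in ring) finsum_cyclic_shift:
  assumes f: "f \<in> UNIV \<rightarrow> carrier R" and "f d = f 0"
  shows "(\<Oplus>j\<in>{..<d}. f (Suc j)) = (\<Oplus>j\<in>{..<d::nat}. f j)"
proof (cases d)
  case (Suc e)
  have c: "(\<Oplus>j\<in>{..e}. f (Suc j)) \<in> carrier R" "finsum R f {..e} \<in> carrier R" "f 0 \<in> carrier R"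
    using f by (auto intro!: finsum_closed)
  have "(\<Oplus>j\<in>{..e}. f (Suc j)) \<oplus> f 0 = f (Suc e) \<oplus> finsum R f {..e}"
    using finsum_Suc2[of f e] finsum_Suc[of f e] f by (simp add: Pi_def)
  then have "(\<Oplus>j\<in>{..e}. f (Suc j)) = finsum R f {..e}"
    using assms(2) Suc c by (simp add: a_comm)
  then show ?thesis using Suc by (simp add: lessThan_Suc_atMost)
qed simp

section \<open>Homomorphisms that fix the fixed ring of a cyclic action\<close>

text \<open>
  For \<open>x \<in> Z\<close>, the trace \<open>x + \<tau>x + \<dots> + \<tau>\<^sup>d\<^sup>-\<^sup>1x\<close> is fixed by \<open>\<tau>\<close>, hence by \<open>\<alpha>\<close>. This is a linear
  relation between the characters \<open>\<tau>\<^sup>j\<close> and \<open>\<alpha>\<tau>\<^sup>j\<close> of \<open>Z\<close>, so two of them must coincide.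
\<close>

lemma (in domain) hom_eq_power_if_fixes_fixed_ring:
  assumes Z: "subring Z R" and \<tau>: "\<tau> \<in> ring_hom (R\<lparr>carrier := Z\<rparr>) (R\<lparr>carrier := Z\<rparr>)"
    and m: "0 < m" "\<And>x. x \<in> Z \<Longrightarrow> (\<tau> ^^ m) x = x"
    and \<alpha>: "\<alpha> \<in> ring_hom (R\<lparr>carrier := Z\<rparr>) R" and inj: "inj_on \<alpha> Z"
    and fix_\<alpha>: "\<And>x. x \<in> Z \<Longrightarrow> \<tau> x = x \<Longrightarrow> \<alpha> x = x"
  shows "\<exists>j. \<forall>x\<in>Z. \<alpha> x = (\<tau> ^^ j) x"
proof (rule ccontr)
  assume no: "\<nexists>j. \<forall>x\<in>Z. \<alpha> x = (\<tau> ^^ j) x"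
  \<comment> \<open>\<open>d\<close> is the exact order of \<open>\<tau>\<close> on
    \<open>Z\<close>, whereas \<open>m\<close> is just some period. Minimality makes the powers
    below \<open>d\<close> pairwise distinct on \<open>Z\<close>.\<close>
  define P where "P = (\<lambda>d. 0 < d \<and> (\<forall>x\<in>Z. (\<tau> ^^ d) x = x))"
  define d where "d = (LEAST d. P d)"
  have "P d" unfolding d_def using m by (intro LeastI[of P m]) (auto simp: P_def)
  then have d: "0 < d" "\<And>x. x \<in> Z \<Longrightarrow> (\<tau> ^^ d) x = x" by (auto simp: P_def)
  have d_min: "\<not> P e" if "e < d" for e using that not_less_Least unfolding d_def by blast
  have Zc: "x \<in> carrier R" if "x \<in> Z" for x using subringE(1)[OF Z] that by blast
  have \<tau>c: "\<tau> x \<in> Z" if "x \<in> Z" for x using ring_hom_memE(1)[OF \<tau>] that by auto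
  have \<alpha>c: "\<alpha> x \<in> carrier R" if "x \<in> Z" for x using ring_hom_memE(1)[OF \<alpha>] that by auto
  have pc: "(\<tau> ^^ j) x \<in> Z" if "x \<in> Z" for j x by (induction j) (use that \<tau>c in auto)
  have pm: "(\<tau> ^^ j) (x \<otimes> y) = (\<tau> ^^ j) x \<otimes> (\<tau> ^^ j) y" if "x \<in> Z" "y \<in> Z" for j x y
    by (induction j) (use that pc ring_hom_memE(2)[OF \<tau>] in auto)
  have p1: "(\<tau> ^^ j) \<one> = \<one>" for j by (induction j) (use ring_hom_memE(4)[OF \<tau>] in auto)
  have pp: "(\<tau> ^^ i) ((\<tau> ^^ j) x) = (\<tau> ^^ (i + j)) x" for i j x by (simp add: funpow_add)
  \<comment> \<open>Every \<open>x\<close> in \<open>Z\<close> is the image under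
    \<open>\<tau> ^^ i\<close> of an element of \<open>Z\<close>, which allows
    \<open>\<tau> ^^ i\<close> to be cancelled on the right.\<close>
  have cycle: "(\<tau> ^^ i) ((\<tau> ^^ (d - i)) x) = x" if "i < d" "x \<in> Z" for i x
    using that d(2) by (simp add: pp)
  have dist: "\<exists>x\<in>Z. (\<tau> ^^ i) x \<noteq> (\<tau> ^^ j) x" if "i < j" "j < d" for i j
  proof (rule ccontr)
    assume "\<not> ?thesis"
    then have eq: "(\<tau> ^^ i) x = (\<tau> ^^ j) x" if "x \<in> Z" for x using that by blast
    have "(\<tau> ^^ (j - i)) x = x" if x: "x \<in> Z" for x
    proof -
      have "(\<tau> ^^ (j - i)) x = (\<tau> ^^ (j - i)) ((\<tau> ^^ i) ((\<tau> ^^ (d - i)) x))"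
        using cycle[of i] \<open>i < j\<close> \<open>j < d\<close> x by simp
      also have "\<dots> = (\<tau> ^^ j) ((\<tau> ^^ (d - i)) x)"
        unfolding pp using \<open>i < j\<close> by simp
      also have "\<dots> = x"
        using eq[OF pc[OF x], symmetric] cycle[of i] \<open>i < j\<close> \<open>j < d\<close> x by simp
      finally show ?thesis .
    qed
    then have "P (j - i)" using \<open>i < j\<close> by (auto simp: P_def)
    then show False using d_min[of "j - i"] that by auto
  qed
  then have dist: "\<exists>x\<in>Z. (\<tau> ^^ i) x \<noteq> (\<tau> ^^ j) x" if "i < d" "j < d" "i \<noteq> j" for i j
    using that by (metis linorder_neqE_nat)
  \<comment> \<open>If \<alpha> after \<open>\<tau> ^^ i\<close> were \<open>\<tau> ^^ l\<close>,
    precomposing with \<open>\<tau> ^^ (d - i)\<close> would exhibit \<alpha> itself as a power of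
    \<tau>, contrary to \<open>no\<close>.\<close>
  have cross: "\<exists>x\<in>Z. \<alpha> ((\<tau> ^^ i) x) \<noteq> (\<tau> ^^ l) x" if "i < d" for i l
  proof (rule ccontr)
    assume "\<not> ?thesis"
    then have eq: "\<alpha> ((\<tau> ^^ i) x) = (\<tau> ^^ l) x" if "x \<in> Z" for x using that by blast
    have "\<alpha> x = (\<tau> ^^ (l + (d - i))) x" if "x \<in> Z" for x
      using eq[OF pc[OF that, of "d - i"]] cycle[OF \<open>i < d\<close> that] pp by simp
    then show False using no by blast
  qed
  \<comment> \<open>There are \<open>2 * d\<close> characters: the tag \<open>True\<close> marks
    those composed with \<alpha>, the tag \<open>False\<close> the plain powers. With coefficients 1
    and -1 the relation reads \<alpha>(T) - T = 0 for the trace T.\<close>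
  define \<chi> where "\<chi> = (\<lambda>(b, j) x. if b then \<alpha> ((\<tau> ^^ j) x) else (\<tau> ^^ j) x)"
  define a where "a = (\<lambda>(b, j::nat). if b then \<one> else \<ominus> \<one>)"
  define I where "I = Pair True ` {..<d} \<union> Pair False ` {..<d}"
  have \<chi>c: "\<chi> i x \<in> carrier R" if "x \<in> Z" for i x
    using that \<alpha>c pc Zc by (auto simp: \<chi>_def split: prod.split)
  have ac: "a i \<in> carrier R" for i by (auto simp: a_def split: prod.split)
  have "\<forall>i\<in>I. a i = \<zero>"
  proof (rule dedekind_independence[where I = I and Y = Z and m = "(\<otimes>)" and \<chi> = \<chi> and a = a])
    show "finite I" by (auto simp: I_def)
    show "x \<otimes> y \<in> Z" if "x \<in> Z" "y \<in> Z" for x y using that subringE(6)[OF Z] by blast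
    show "\<chi> i x \<in> carrier R" if "x \<in> Z" for i x by (rule \<chi>c) fact
    show "\<chi> i (x \<otimes> y) = \<chi> i x \<otimes> \<chi> i y" if "x \<in> Z" "y \<in> Z" for i x y
      using that pm pc ring_hom_memE(2)[OF \<alpha>] by (auto simp: \<chi>_def split: prod.split)
    show "\<exists>x\<in>Z. \<chi> i x \<noteq> \<zero>" for i
      using subringE(3)[OF Z] p1 ring_hom_memE(4)[OF \<alpha>]
      by (intro bexI[of _ \<one>]) (auto simp: \<chi>_def split: prod.split)
    show "a i \<in> carrier R" for i by (rule ac)
    show "\<exists>x\<in>Z. \<chi> i x \<noteq> \<chi> j x" if "i \<in> I" "j \<in> I" "i \<noteq> j" for i j
    proof -
      obtain b k b' l where [simp]: "i = (b, k)" "j = (b', l)" by fastforce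
      have kl: "k < d" "l < d" using that by (auto simp: I_def)
      show ?thesis
      proof (cases "b = b'")
        case True
        then obtain x where x: "x \<in> Z" "(\<tau> ^^ k) x \<noteq> (\<tau> ^^ l) x"
          using dist kl \<open>i \<noteq> j\<close> by auto
        \<comment> \<open>Injectivity of \<alpha> keeps the characters tagged \<open>True\<close>
          distinct from each other; characters with different tags are separated by
          \<open>cross\<close>.\<close>
        then have "\<alpha> ((\<tau> ^^ k) x) \<noteq> \<alpha> ((\<tau> ^^ l) x)"
          using inj pc by (auto dest: inj_onD)
        with x show ?thesis using True by (auto simp: \<chi>_def)
      next
        case False
        then show ?thesis using cross[OF kl(1), of l] cross[OF kl(2), of k]
          by (cases b; cases b') (auto simp: \<chi>_def, metis)
      qed
    qed
    show "(\<Oplus>i\<in>I. a i \<otimes> \<chi> i x) = \<zero>" if x: "x \<in> Z" for x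
    proof -
      define T where "T = (\<Oplus>j\<in>{..<d}. (\<tau> ^^ j) x)"
      have \<tau>': "\<tau> \<in> ring_hom (R\<lparr>carrier := Z\<rparr>) R"
        using \<tau> Zc by (auto simp: ring_hom_def)
      have T: "T \<in> Z" "\<tau> T = (\<Oplus>j\<in>{..<d}. (\<tau> ^^ Suc j) x)"
        "\<alpha> T = (\<Oplus>j\<in>{..<d}. \<alpha> ((\<tau> ^^ j) x))"
        using hom_finsum_on_subring[OF Z \<tau>', of "{..<d}" "\<lambda>j. (\<tau> ^^ j) x"]
          hom_finsum_on_subring[OF Z \<alpha>, of "{..<d}" "\<lambda>j. (\<tau> ^^ j) x"] pc[OF x]
        by (auto simp: T_def)
      have "\<tau> T = T"
        unfolding T(2) unfolding T_def
        using finsum_cyclic_shift[of "\<lambda>j. (\<tau> ^^ j) x" d] pc[OF x] Zc d(2)[OF x] by auto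
      then have \<alpha>T: "\<alpha> T = T" using fix_\<alpha> T(1) by blast
      have Tc: "T \<in> carrier R" using T(1) Zc by blast
      have c: "(\<lambda>i. a i \<otimes> \<chi> i x) \<in> J \<rightarrow> carrier R" for J using ac \<chi>c[OF x] by auto
      have "(\<Oplus>i\<in>I. a i \<otimes> \<chi> i x) =
        (\<Oplus>i\<in>Pair True ` {..<d}. a i \<otimes> \<chi> i x) \<oplus> (\<Oplus>i\<in>Pair False ` {..<d}. a i \<otimes> \<chi> i x)"
        unfolding I_def by (rule finsum_Un_disjoint) (use c in auto)
      also have "(\<Oplus>i\<in>Pair True ` {..<d}. a i \<otimes> \<chi> i x) =
        (\<Oplus>j\<in>{..<d}. a (True, j) \<otimes> \<chi> (True, j) x)"
        by (rule finsum_reindex[OF c]) (simp add: inj_on_def)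
      also have "\<dots> = \<alpha> T"
        unfolding T(3) using pc[OF x] \<alpha>c by (intro finsum_cong') (auto simp: a_def \<chi>_def)
      also have "(\<Oplus>i\<in>Pair False ` {..<d}. a i \<otimes> \<chi> i x) =
        (\<Oplus>j\<in>{..<d}. a (False, j) \<otimes> \<chi> (False, j) x)"
        by (rule finsum_reindex[OF c]) (simp add: inj_on_def)
      also have "\<dots> = (\<Oplus>j\<in>{..<d}. \<ominus> \<one> \<otimes> (\<tau> ^^ j) x)"
        using pc[OF x] Zc by (intro finsum_cong') (auto simp: a_def \<chi>_def)
      also have "\<dots> = \<ominus> \<one> \<otimes> T"
        unfolding T_def using pc[OF x] Zc by (intro finsum_rdistr[symmetric]) auto
      finally show ?thesis using \<alpha>T Tc by (simp add: l_minus r_neg)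
    qed
  qed
  \<comment> \<open>Since \<open>0 < d\<close>, the index \<open>(True, 0)\<close> occurs, and its
    coefficient 1 would have to vanish.\<close>
  then have "a (True, 0) = \<zero>" using d(1) by (simp add: I_def)
  then show False by (simp add: a_def)
qed

section \<open>Automorphism groups of fields and solvability\<close>

text \<open>By induction, step \<open>i\<close> of the derived series lies in
  \<open>H (k - i)\<close>: a subgroup that contains all commutators contains the subgroup they
  generate. After \<open>k\<close> steps the series has reached \<open>H 0\<close>.\<close>

lemma (in group) solvable_if_derived_chain:
  assumes "\<And>i. i \<le> k \<Longrightarrow> subgroup (H i) G" and "H 0 = {\<one>}" and "H k = carrier G"
    and "\<And>i. i < k \<Longrightarrow> derived_set G (H (Suc i)) \<subseteq> H i"
  shows "solvable G"
proof -
  have "(derived G ^^ i) (carrier G) \<subseteq> H (k - i)" if "i \<le> k" for i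
    using that
  proof (induction i)
    case (Suc i)
    then have k: "k - i = Suc (k - Suc i)" "k - Suc i < k" by auto
    have "derived G ((derived G ^^ i) (carrier G)) \<subseteq> derived G (H (k - i))"
      using Suc by (intro mono_derived) auto
    also have "\<dots> \<subseteq> H (k - Suc i)"
      unfolding derived_def k(1)
      using assms(1,4) k(2) by (intro generate_subgroup_incl) auto
    finally show ?case by simp
  qed (use assms(3) in auto)
  from this[of k] have "(derived G ^^ k) (carrier G) \<subseteq> {\<one>}" using assms(2) by simp
  moreover have "\<one> \<in> (derived G ^^ k) (carrier G)"
    using exp_of_derived_is_subgroup[OF subgroup_self] subgroup.one_closed by blast
  ultimately show ?thesis unfolding solvable_iff_trivial_derived_seq by blast
qed

section \<open>Groups of automorphisms and their commutators\<close>

lemma Aut_over_simps: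
  "carrier (Aut_over R Z M) =
    {\<alpha> \<in> Bij M. \<alpha> \<in> ring_iso (R\<lparr>carrier := M\<rparr>) (R\<lparr>carrier := M\<rparr>) \<and> (\<forall>z\<in>Z. \<alpha> z = z)}"
  "Aut_over R Z M = BijGroup M \<lparr>carrier := carrier (Aut_over R Z M)\<rparr>"
  by (simp_all add: Aut_over_def)

lemma mult_BijGroup_apply:
  "\<alpha> \<in> Bij M \<Longrightarrow> \<beta> \<in> Bij M \<Longrightarrow> x \<in> M \<Longrightarrow> (\<alpha> \<otimes>\<^bsub>BijGroup M\<^esub> \<beta>) x = \<alpha> (\<beta> x)"
  by (simp add: BijGroup_def compose_eq)

lemma subgroup_Aut_over:
  assumes M: "ring (R\<lparr>carrier := M\<rparr>)" and Z: "Z \<subseteq> M"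
  shows "subgroup (carrier (Aut_over R Z M)) (BijGroup M)"
proof -
  interpret M: ring "R\<lparr>carrier := M\<rparr>" by fact
  let ?M = "R\<lparr>carrier := M\<rparr>"
  have cl: "\<alpha> x \<in> M" if "\<alpha> \<in> Bij M" "x \<in> M" for \<alpha> x using Bij_imp_funcset that by blast
  \<comment> \<open>Products and inverses in \<open>BijGroup M\<close> are composition and inversion
    restricted to \<open>M\<close>. Being an automorphism depends only on the values on
    \<open>M\<close>, so it passes to the restricted maps.\<close>
  have ext: "\<beta> \<in> ring_iso ?M ?M"
    if "\<alpha> \<in> ring_iso ?M ?M" "\<And>x. x \<in> M \<Longrightarrow> \<beta> x = \<alpha> x" for \<alpha> \<beta>
  proof -
    have "bij_betw \<beta> M M"
      using that bij_betw_cong[of M \<beta> \<alpha> M] ring_iso_memE(5)[OF that(1)] by auto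
    then show ?thesis
      using that ring_iso_memE(1-4)[OF that(1)] M.m_closed M.a_closed M.one_closed
      by (auto intro!: ring_iso_memI)
  qed
  interpret B: group "BijGroup M" by (rule group_BijGroup)
  show ?thesis
  proof (rule B.subgroupI)
    show "carrier (Aut_over R Z M) \<subseteq> carrier (BijGroup M)"
      by (auto simp: Aut_over_simps(1) BijGroup_def)
    have "id \<in> ring_iso ?M ?M" by (rule ring_iso_memI) auto
    then have "(\<lambda>x\<in>M. x) \<in> carrier (Aut_over R Z M)"
      using id_Bij[of M] Z by (auto simp: Aut_over_simps(1) intro: ext)
    then show "carrier (Aut_over R Z M) \<noteq> {}" by blast
  next
    fix \<alpha> assume s: "\<alpha> \<in> carrier (Aut_over R Z M)"
    then have b: "\<alpha> \<in> Bij M" by (auto simp: Aut_over_simps(1))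
    have "inv_into M \<alpha> \<in> ring_iso ?M ?M"
      using ring_iso_set_sym[OF M, of \<alpha> ?M] s by (auto simp: Aut_over_simps(1))
    then have "(\<lambda>x\<in>M. inv_into M \<alpha> x) \<in> ring_iso ?M ?M" by (rule ext) auto
    moreover have "inv_into M \<alpha> z = z" if "z \<in> Z" for z
      using that s b Z by (intro inv_into_f_eq) (auto simp: Aut_over_simps(1) Bij_def bij_betw_def)
    ultimately show "inv\<^bsub>BijGroup M\<^esub> \<alpha> \<in> carrier (Aut_over R Z M)"
      using restrict_inv_into_Bij[OF b] Z
      by (auto simp: Aut_over_simps(1) inv_BijGroup[OF b])
  next
    fix \<alpha> \<beta> assume sr: "\<alpha> \<in> carrier (Aut_over R Z M)" "\<beta> \<in> carrier (Aut_over R Z M)"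
    then have b: "\<alpha> \<in> Bij M" "\<beta> \<in> Bij M" by (auto simp: Aut_over_simps(1))
    note app = mult_BijGroup_apply[OF b]
    have "\<alpha> \<circ> \<beta> \<in> ring_iso ?M ?M"
      using sr ring_iso_set_trans[of \<beta> ?M ?M \<alpha> ?M] by (auto simp: Aut_over_simps(1))
    then have "\<alpha> \<otimes>\<^bsub>BijGroup M\<^esub> \<beta> \<in> ring_iso ?M ?M" by (rule ext) (simp add: app)
    moreover have "\<alpha> \<otimes>\<^bsub>BijGroup M\<^esub> \<beta> \<in> Bij M"
      using B.m_closed b by (auto simp: BijGroup_def)
    moreover have "(\<alpha> \<otimes>\<^bsub>BijGroup M\<^esub> \<beta>) z = z" if "z \<in> Z" for z
      using that Z app[of z] sr by (auto simp: Aut_over_simps(1))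
    ultimately show "\<alpha> \<otimes>\<^bsub>BijGroup M\<^esub> \<beta> \<in> carrier (Aut_over R Z M)"
      by (auto simp: Aut_over_simps(1))
  qed
qed

text \<open>A commutator acts trivially wherever its two factors commute. All groups are kept inside
  \<open>BijGroup M\<close>, so that the groups over different sets \<open>Z\<close> and
  \<open>W\<close> share their operations.\<close>

lemma derived_set_Aut_over:
  assumes M: "ring (R\<lparr>carrier := M\<rparr>)" and "Z \<subseteq> M" "W \<subseteq> M"
    and commute: "\<And>\<alpha> \<beta> x. \<lbrakk>\<alpha> \<in> carrier (Aut_over R W M); \<beta> \<in> carrier (Aut_over R W M); x \<in> Z\<rbrakk>
      \<Longrightarrow> \<alpha> (\<beta> x) = \<beta> (\<alpha> x)"
  shows "derived_set (BijGroup M) (carrier (Aut_over R W M)) \<subseteq> carrier (Aut_over R Z M)"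
proof -
  interpret B: group "BijGroup M" by (rule group_BijGroup)
  interpret S: subgroup "carrier (Aut_over R W M)" "BijGroup M"
    by (rule subgroup_Aut_over) fact+
  note app = mult_BijGroup_apply[of _ M]
  have cB: "carrier (BijGroup M) = Bij M" by (simp add: BijGroup_def)
  have "\<alpha> \<otimes>\<^bsub>BijGroup M\<^esub> \<beta> \<otimes>\<^bsub>BijGroup M\<^esub> inv\<^bsub>BijGroup M\<^esub> \<alpha> \<otimes>\<^bsub>BijGroup M\<^esub> inv\<^bsub>BijGroup M\<^esub> \<beta>
      \<in> carrier (Aut_over R Z M)" (is "?c \<in> _")
    if s: "\<alpha> \<in> carrier (Aut_over R W M)" and r: "\<beta> \<in> carrier (Aut_over R W M)" for \<alpha> \<beta>
  proof -
    let ?s = "inv\<^bsub>BijGroup M\<^esub> \<alpha>" and ?r = "inv\<^bsub>BijGroup M\<^esub> \<beta>"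
    have mem: "?s \<in> carrier (Aut_over R W M)" "?r \<in> carrier (Aut_over R W M)"
      using s r by auto
    have b: "\<alpha> \<in> Bij M" "\<beta> \<in> Bij M" "?s \<in> Bij M" "?r \<in> Bij M"
      using s r mem by (auto simp: Aut_over_simps(1))
    have cl: "f \<otimes>\<^bsub>BijGroup M\<^esub> g \<in> Bij M" if "f \<in> Bij M" "g \<in> Bij M" for f g
      using B.m_closed that unfolding cB .
    have cancel: "f ((inv\<^bsub>BijGroup M\<^esub> f) x) = x" if "f \<in> Bij M" "x \<in> M" for f x
      using that by (simp add: inv_BijGroup f_inv_into_f Bij_def bij_betw_def)
    have clM: "f x \<in> M" if "f \<in> Bij M" "x \<in> M" for f x using Bij_imp_funcset that by blast
    have "?c x = x" if x: "x \<in> Z" for x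
    proof -
      have xM: "x \<in> M" using x assms(2) by blast
      have "?c x = \<alpha> (\<beta> (?s (?r x)))" using b cl xM clM by (simp add: app)
      \<comment> \<open>Commutation is used for the inverses: they also fix \<open>W\<close>, and
        they are the maps that meet \<open>x\<close> while it is still known to lie in
        \<open>Z\<close>.\<close>
      also have "\<dots> = \<alpha> (\<beta> (?r (?s x)))" using commute[OF mem x] by simp
      also have "\<dots> = x"
        using cancel[OF b(2) clM[OF b(3) xM]] cancel[OF b(1) xM] by simp
      finally show ?thesis .
    qed
    moreover have "?c \<in> carrier (Aut_over R W M)" using s r by auto
    ultimately show ?thesis by (auto simp: Aut_over_simps(1))
  qed
  then show ?thesis by auto
qed

section \<open>Centers in the chain\<close>

text \<open>The isomorphism makes \<open>z\<close> a constant polynomial, and multiplying it with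
  the sum of the p_i t^i gives the coefficients z p_i on one side and p_i \<tau>^i(z) on the other.
  These agree already in the twisted polynomial ring, so the equality survives taking remainders
  modulo \<open>f\<close>.\<close>

lemma fixed_central_in_center_twisted_quotient:
  assumes S: "ring S" and T: "ring T" and \<tau>: "\<tau> \<in> ring_hom S S" and sub: "carrier S \<subseteq> carrier T"
    and iso: "iso_twisted_quotient T S \<tau> f"
    and z: "z \<in> ring_center S" "\<tau> z = z"
  shows "z \<in> ring_center T"
proof -
  interpret S: ring S by fact
  from iso obtain \<phi> where \<phi>: "\<phi> \<in> ring_iso T (twisted_quotient S \<tau> f)"
    "\<And>a. a \<in> carrier S \<Longrightarrow> \<phi> a = const_poly S \<tau> a"
    unfolding iso_twisted_quotient_def by blast
  have zS: "z \<in> carrier S" "\<And>x. x \<in> carrier S \<Longrightarrow> z \<otimes>\<^bsub>S\<^esub> x = x \<otimes>\<^bsub>S\<^esub> z"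
    using z unfolding ring_center_def by blast+
  let ?z = "\<lambda>i. if i = (0::nat) then z else \<zero>\<^bsub>S\<^esub>"
  have \<phi>z: "\<phi> z = ?z" using \<phi>(2)[OF zS(1)] zS(1)
    by (simp add: const_poly_def twisted_UP_def UP_def)
  have z_up: "?z \<in> up S" using zS(1) by (auto intro!: mem_upI)
  have \<tau>0: "\<tau> \<zero>\<^bsub>S\<^esub> = \<zero>\<^bsub>S\<^esub>" using ring_hom_zero[OF \<tau> S S] .
  have pow: "(\<tau> ^^ i) \<zero>\<^bsub>S\<^esub> = \<zero>\<^bsub>S\<^esub>" "(\<tau> ^^ i) z = z" for i by (induction i) (use \<tau>0 z in auto)
  have "z \<otimes>\<^bsub>T\<^esub> b = b \<otimes>\<^bsub>T\<^esub> z" if b: "b \<in> carrier T" for b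
  proof -
    have "\<phi> b \<in> polys_below S (deg S f)"
      using ring_iso_memE(1)[OF \<phi>(1) b] by (simp add: twisted_quotient_def)
    then have p: "\<phi> b \<in> up S" by (simp add: polys_below_def)
    then have pc: "\<phi> b n \<in> carrier S" for n by auto
    have "(\<Oplus>\<^bsub>S\<^esub>i\<in>{..n}. ?z i \<otimes>\<^bsub>S\<^esub> (\<tau> ^^ i) (\<phi> b (n - i)))
        = (\<Oplus>\<^bsub>S\<^esub>i\<in>{..n}. \<phi> b i \<otimes>\<^bsub>S\<^esub> (\<tau> ^^ i) (?z (n - i)))" for n
    proof -
      have tc: "(\<tau> ^^ i) x \<in> carrier S" if "x \<in> carrier S" for i x
        by (induction i) (use that ring_hom_memE(1)[OF \<tau>] in auto)
      \<comment> \<open>In the convolution only the summand \<open>i = 0\<close> survives when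
        \<open>z\<close> stands on the left, and only \<open>i = n\<close> when it stands on the
        right.\<close>
      have "(\<Oplus>\<^bsub>S\<^esub>i\<in>{..n}. ?z i \<otimes>\<^bsub>S\<^esub> (\<tau> ^^ i) (\<phi> b (n - i)))
        = (\<Oplus>\<^bsub>S\<^esub>i\<in>{..n}. if 0 = i then z \<otimes>\<^bsub>S\<^esub> \<phi> b (n - i) else \<zero>\<^bsub>S\<^esub>)"
        using pc tc zS(1) by (intro S.finsum_cong') auto
      also have "\<dots> = z \<otimes>\<^bsub>S\<^esub> \<phi> b n"
        using pc zS(1) S.finsum_singleton[of 0 "{..n}" "\<lambda>i. z \<otimes>\<^bsub>S\<^esub> \<phi> b (n - i)"] by auto
      also have "\<dots> = \<phi> b n \<otimes>\<^bsub>S\<^esub> z" by (rule zS(2)[OF pc])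
      also have "\<dots> = (\<Oplus>\<^bsub>S\<^esub>i\<in>{..n}. if n = i then \<phi> b i \<otimes>\<^bsub>S\<^esub> z else \<zero>\<^bsub>S\<^esub>)"
        using pc zS(1) S.finsum_singleton[of n "{..n}" "\<lambda>i. \<phi> b i \<otimes>\<^bsub>S\<^esub> z"] by auto
      also have "\<dots> = (\<Oplus>\<^bsub>S\<^esub>i\<in>{..n}. \<phi> b i \<otimes>\<^bsub>S\<^esub> (\<tau> ^^ i) (?z (n - i)))"
        using pc tc zS(1) pow by (intro S.finsum_cong') auto
      finally show ?thesis .
    qed
    then have "?z \<otimes>\<^bsub>twisted_UP S \<tau>\<^esub> \<phi> b = \<phi> b \<otimes>\<^bsub>twisted_UP S \<tau>\<^esub> ?z"
      using p z_up by (simp add: twisted_UP_def)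
    then have "?z \<otimes>\<^bsub>twisted_quotient S \<tau> f\<^esub> \<phi> b = \<phi> b \<otimes>\<^bsub>twisted_quotient S \<tau> f\<^esub> ?z"
      by (simp add: twisted_quotient_def)
    moreover have zT: "z \<in> carrier T" using zS(1) sub by blast
    ultimately have "\<phi> (z \<otimes>\<^bsub>T\<^esub> b) = \<phi> (b \<otimes>\<^bsub>T\<^esub> z)"
      using ring_iso_memE(2)[OF \<phi>(1)] b \<phi>z by simp
    moreover have "inj_on \<phi> (carrier T)" using ring_iso_memE(5)[OF \<phi>(1)] by (simp add: bij_betw_def)
    moreover have "z \<otimes>\<^bsub>T\<^esub> b \<in> carrier T" "b \<otimes>\<^bsub>T\<^esub> z \<in> carrier T"
      using monoid.m_closed[OF ring.is_monoid[OF T]] b zT by auto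
    ultimately show ?thesis by (metis inj_onD)
  qed
  then show ?thesis using zS(1) sub unfolding ring_center_def by blast
qed

lemma ring_iso_center:
  assumes S: "ring S" and \<tau>: "\<tau> \<in> ring_iso S S" and z: "z \<in> ring_center S"
  shows "\<tau> z \<in> ring_center S"
proof -
  have zS: "z \<in> carrier S" "\<And>x. x \<in> carrier S \<Longrightarrow> z \<otimes>\<^bsub>S\<^esub> x = x \<otimes>\<^bsub>S\<^esub> z"
    using z unfolding ring_center_def by blast+
  have "\<tau> z \<otimes>\<^bsub>S\<^esub> y = y \<otimes>\<^bsub>S\<^esub> \<tau> z" if "y \<in> carrier S" for y
  proof -
    have "y \<in> \<tau> ` carrier S" using that ring_iso_memE(5)[OF \<tau>] by (simp add: bij_betw_def)
    then obtain x where x: "x \<in> carrier S" "y = \<tau> x" by (rule imageE)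
    have "\<tau> (z \<otimes>\<^bsub>S\<^esub> x) = \<tau> (x \<otimes>\<^bsub>S\<^esub> z)" using zS(2)[OF x(1)] by simp
    then show ?thesis using zS(1) x by (simp add: ring_iso_memE(2)[OF \<tau>])
  qed
  then show ?thesis using zS(1) ring_iso_memE(1)[OF \<tau>] unfolding ring_center_def by blast
qed

lemma inner_automorphism_center:
  assumes "ring S" "inner_automorphism S \<tau>" "z \<in> ring_center S"
  shows "\<tau> z = z"
proof -
  interpret S: ring S by fact
  obtain u where u: "u \<in> Units S" "\<tau> z = u \<otimes>\<^bsub>S\<^esub> z \<otimes>\<^bsub>S\<^esub> inv\<^bsub>S\<^esub> u"
    using assms(2,3) unfolding inner_automorphism_def ring_center_def by blast
  have z: "z \<in> carrier S" "u \<otimes>\<^bsub>S\<^esub> z = z \<otimes>\<^bsub>S\<^esub> u"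
    using assms(3) S.Units_closed[OF u(1)] unfolding ring_center_def by force+
  have "z \<otimes>\<^bsub>S\<^esub> u \<otimes>\<^bsub>S\<^esub> inv\<^bsub>S\<^esub> u = z"
    using z(1) u(1) by (simp add: S.m_assoc S.Units_closed)
  then show ?thesis using u(2) z(2) by simp
qed

section \<open>The filtration of the group by the stabilizers of the centers\<close>

theorem theorem13:
  fixes A :: "('a, 'b) ring_scheme"
    and F M :: "'a set"
    and n k :: nat
    and G :: "('a \<Rightarrow> 'a) monoid"
    and B :: "nat \<Rightarrow> 'a set"
    and q :: "nat \<Rightarrow> nat"
    and \<tau> :: "nat \<Rightarrow> 'a \<Rightarrow> 'a"
    and c :: "nat \<Rightarrow> 'a"
  defines "G \<equiv> Aut_over A F M"
  assumes "central_simple_algebra F A"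
    and "maximal_subfield M F A"
    and "ring.dimension A n F M"
    and "carrier G \<noteq> {\<one>\<^bsub>G\<^esub>}"
    and "B 0 = M"
    and "\<And>i. i < k \<Longrightarrow> B i \<subseteq> B (Suc i)"
    and "\<And>i. i \<le> k \<Longrightarrow> subring (B i) A"
    and "\<And>i. i \<le> k \<Longrightarrow> F \<subseteq> B i"
    and "\<And>i. i \<le> k \<Longrightarrow>
      maximal_subfield M (ring_center (A\<lparr>carrier := B i\<rparr>)) (A\<lparr>carrier := B i\<rparr>)"
    and "crossed_product_algebra G (fixed_field M G) M (A\<lparr>carrier := B k\<rparr>)"
    and "\<And>i. i < k \<Longrightarrow> Factorial_Ring.prime (q i)"
    and "\<And>i. i < k \<Longrightarrow> \<tau> i \<in> ring_iso (A\<lparr>carrier := B i\<rparr>) (A\<lparr>carrier := B i\<rparr>)"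
    and "\<And>i x. i < k \<Longrightarrow> x \<in> F \<Longrightarrow> \<tau> i x = x"
    and "\<And>i. i < k \<Longrightarrow> has_inner_order (A\<lparr>carrier := B i\<rparr>) (\<tau> i) (q i)"
    and "\<And>i. i < k \<Longrightarrow> restrict (\<tau> i) M \<in> carrier G"
    and "\<And>i. i < k \<Longrightarrow> c i \<in> Units (fixed_ring (A\<lparr>carrier := B i\<rparr>) (\<tau> i))"
    and "\<And>i. i < k \<Longrightarrow>
      iso_twisted_quotient (A\<lparr>carrier := B (Suc i)\<rparr>) (A\<lparr>carrier := B i\<rparr>) (\<tau> i)
        (binomial_poly (A\<lparr>carrier := B i\<rparr>) (\<tau> i) (q i) (c i))"
  shows "solvable G"
proof -
  note M_field = assms(3) and B0 = assms(6) and B_mono = assms(7) and B_ring = assms(8)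
    and F_B = assms(9) and B_max = assms(10) and crossed = assms(11) and \<tau>_iso = assms(13)
    and \<tau>_order = assms(15) and iso = assms(18)
  define S where "S = (\<lambda>i. A\<lparr>carrier := B i\<rparr>)"
  define Z where "Z = (\<lambda>i. ring_center (S i))"
  let ?M = "A\<lparr>carrier := M\<rparr>"
  interpret A: ring A using assms(2) by (simp add: central_simple_algebra_def)
  have M: "subfield M A" and FM: "F \<subseteq> M" using M_field by (auto simp: maximal_subfield_def)
  interpret M: field ?M using A.subfield_iff(2)[OF M] .
  have S_ring: "ring (S i)" if "i \<le> k" for i
    unfolding S_def using A.subring_is_ring B_ring that by blast
  have Z_sub: "subfield (Z i) (S i)" "Z i \<subseteq> M" if "i \<le> k" for i
    using B_max[OF that] by (auto simp: maximal_subfield_def central_simple_algebra_def Z_def S_def)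
  have F_Z: "F \<subseteq> Z i" if "i \<le> k" for i
  proof
    fix x assume x: "x \<in> F"
    have "F = ring_center A" using assms(2) by (simp add: central_simple_algebra_def)
    then have "x \<otimes>\<^bsub>A\<^esub> y = y \<otimes>\<^bsub>A\<^esub> x" if "y \<in> carrier A" for y
      using x that by (auto simp: ring_center_def)
    then show "x \<in> Z i"
      using x F_B[OF that] subringE(1)[OF B_ring[OF that]] by (auto simp: Z_def S_def ring_center_def)
  qed
  \<comment> \<open>Independence of characters requires a commutative domain, so each center is
    regarded as a subring of the field \<open>?M\<close> instead of the algebra
    \<open>S i\<close>.\<close>
  have Z_subring: "subring (Z i) ?M" if "i \<le> k" for i
  proof -
    have "ring (S i\<lparr>carrier := Z i\<rparr>)"
      using ring.subring_is_ring[OF S_ring[OF that]] subfieldE(1)[OF Z_sub(1)[OF that]] by blast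
    then show ?thesis
      using M.subring_iff[of "Z i"] Z_sub(2)[OF that] by (simp add: S_def)
  qed
  have power: "\<exists>j. \<forall>x\<in>Z i. \<alpha> x = (\<tau> i ^^ j) x"
    if i: "i < k" and \<alpha>: "\<alpha> \<in> carrier (Aut_over A (Z (Suc i)) M)" for i \<alpha>
  proof -
    have ik: "i \<le> k" using i by simp
    have \<tau>: "\<tau> i \<in> ring_iso (S i) (S i)" using \<tau>_iso[OF i] by (simp add: S_def)
    have \<tau>_hom: "\<tau> i \<in> ring_hom (S i) (S i)" using \<tau> by (simp add: ring_iso_def)
    have Z_S: "x \<in> carrier (S i)" if "x \<in> Z i" for x using that by (auto simp: Z_def ring_center_def)
    have \<alpha>_iso: "\<alpha> \<in> ring_iso ?M ?M" and \<alpha>_fix: "\<And>z. z \<in> Z (Suc i) \<Longrightarrow> \<alpha> z = z"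
      using \<alpha> by (auto simp: Aut_over_simps(1))
    show ?thesis
    \<comment> \<open>The inner order \<open>q i\<close> serves as a period of
      \<open>\<tau> i\<close> on the center, where the inner automorphism
      \<open>\<tau> i ^^ q i\<close> is the identity.\<close>
    proof (rule M.hom_eq_power_if_fixes_fixed_ring[OF Z_subring[OF ik], where m = "q i"])
      show "\<tau> i \<in> ring_hom (?M\<lparr>carrier := Z i\<rparr>) (?M\<lparr>carrier := Z i\<rparr>)"
        using ring_iso_center[OF S_ring[OF ik] \<tau>] ring_hom_memE[OF \<tau>_hom] Z_S
        by (intro ring_hom_memI) (auto simp: Z_def S_def)
      show "0 < q i" using \<tau>_order[OF i] by (simp add: has_inner_order_def)
      show "(\<tau> i ^^ q i) x = x" if "x \<in> Z i" for x
        using \<tau>_order[OF i] inner_automorphism_center[OF S_ring[OF ik], of "\<tau> i ^^ q i" x] that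
        by (auto simp: has_inner_order_def Z_def S_def)
      show "\<alpha> \<in> ring_hom (?M\<lparr>carrier := Z i\<rparr>) ?M"
        using ring_iso_memE(1-4)[OF \<alpha>_iso] subsetD[OF Z_sub(2)[OF ik]] by (intro ring_hom_memI) auto
      show "inj_on \<alpha> (Z i)"
        using ring_iso_memE(5)[OF \<alpha>_iso] Z_sub(2)[OF ik] by (auto simp: bij_betw_def intro: inj_on_subset)
      show "\<alpha> x = x" if x: "x \<in> Z i" "\<tau> i x = x" for x
      proof (rule \<alpha>_fix)
        show "x \<in> Z (Suc i)"
          unfolding Z_def
          by (rule fixed_central_in_center_twisted_quotient[OF S_ring[OF ik] S_ring \<tau>_hom])
            (use iso[OF i] B_mono[OF i] x i in \<open>auto simp: S_def Z_def\<close>)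
      qed
    qed
  qed
  have commute: "\<alpha> (\<beta> x) = \<beta> (\<alpha> x)"
    if i: "i < k" and \<alpha>: "\<alpha> \<in> carrier (Aut_over A (Z (Suc i)) M)"
      and \<beta>: "\<beta> \<in> carrier (Aut_over A (Z (Suc i)) M)" and x: "x \<in> Z i" for i \<alpha> \<beta> x
  proof -
    \<comment> \<open>The orbit of \<open>x\<close> stays in \<open>Z i\<close>, so the description
      of \<alpha> as a power of \<open>\<tau> i\<close> is still valid at \<beta>(x), and
      conversely.\<close>
    have \<tau>_Z: "(\<tau> i ^^ j) x \<in> Z i" for j
      by (induction j)
        (use x ring_iso_center[OF S_ring, of i "\<tau> i"] \<tau>_iso[OF i] i in \<open>auto simp: Z_def S_def\<close>)
    obtain j l where jl: "\<forall>x\<in>Z i. \<alpha> x = (\<tau> i ^^ j) x" "\<forall>x\<in>Z i. \<beta> x = (\<tau> i ^^ l) x"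
      using power[OF i \<alpha>] power[OF i \<beta>] by blast
    have "\<alpha> (\<beta> x) = (\<tau> i ^^ (j + l)) x" using jl x \<tau>_Z by (simp add: funpow_add)
    also have "\<dots> = \<beta> (\<alpha> x)" using jl x \<tau>_Z by (simp add: funpow_add add.commute[of j])
    finally show ?thesis .
  qed
  define H where "H = (\<lambda>i. carrier (Aut_over A (Z i) M))"
  have H_sub: "subgroup (H i) (BijGroup M)" if "i \<le> k" for i
    unfolding H_def using subgroup_Aut_over[OF M.is_ring Z_sub(2)[OF that]] .
  have G_sub: "subgroup (carrier G) (BijGroup M)"
    unfolding assms(1) by (rule subgroup_Aut_over[OF M.is_ring FM])
  have G_eq: "G = BijGroup M\<lparr>carrier := carrier G\<rparr>"
    unfolding assms(1) by (rule Aut_over_simps(2))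
  have H_G: "H i \<subseteq> carrier G" if "i \<le> k" for i
    using F_Z[OF that] by (auto simp: H_def assms(1) Aut_over_simps(1))
  interpret G: group G
    using subgroup.subgroup_is_group[OF G_sub group_BijGroup] G_eq by simp
  show ?thesis
  proof (rule G.solvable_if_derived_chain)
    show "subgroup (H i) G" if "i \<le> k" for i
      using group.subgroup_incl[OF group_BijGroup H_sub[OF that] G_sub H_G[OF that]] G_eq by simp
    \<comment> \<open>The bottom algebra is the commutative field \<open>M\<close>, so its center is
      all of \<open>M\<close>. Extensionality then leaves the restricted identity as the only
      element of \<open>H 0\<close>.\<close>
    have "M \<subseteq> Z 0"
      using M.m_comm B0 by (auto simp: Z_def S_def ring_center_def)
    then have "H 0 \<subseteq> {\<lambda>x\<in>M. x}"
      by (auto simp: H_def Aut_over_simps(1) Bij_def intro!: extensionalityI[of _ M])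
    moreover have one: "\<one>\<^bsub>G\<^esub> = (\<lambda>x\<in>M. x)"
      by (subst G_eq) (simp add: BijGroup_def)
    moreover have "\<one>\<^bsub>G\<^esub> \<in> H 0"
      using subgroup.one_closed[OF H_sub[of 0]] one by (simp add: BijGroup_def)
    ultimately show "H 0 = {\<one>\<^bsub>G\<^esub>}" by auto
    \<comment> \<open>The crossed product condition identifies the top center with the fixed field
      of \<open>G\<close>, which all of \<open>G\<close> fixes pointwise by definition.\<close>
    have "Z k = fixed_field M G"
      using crossed by (simp add: crossed_product_algebra_def central_simple_algebra_def Z_def S_def)
    then have "carrier G \<subseteq> H k"
      by (auto simp: H_def assms(1) Aut_over_simps(1) fixed_field_def)
    then show "H k = carrier G" using H_G by blast
    show "derived_set G (H (Suc i)) \<subseteq> H i" if i: "i < k" for i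
    proof -
      \<comment> \<open>Commutators formed in \<open>G\<close> and in \<open>BijGroup M\<close> are
        the same, which moves the inclusion to the ambient group where
        \<open>derived_set_Aut_over\<close> is stated.\<close>
      have "derived_set G (H (Suc i)) = derived_set (BijGroup M) (H (Suc i))"
        using group.derived_set_consistent[OF group_BijGroup H_G G_sub, of "Suc i"] i G_eq by simp
      also have "\<dots> \<subseteq> H i"
        unfolding H_def
        by (rule derived_set_Aut_over[OF M.is_ring]) (use Z_sub(2) i commute in auto)
      finally show ?thesis .
    qed
  qed
qed

end
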